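(* Let $G$ be a finite, simple, connected graph of order $n(G)\geq 5$ with clique number $\omega(G)=4$. Then the local metric dimension of $G$ satisfies $\dim_l(G)\leq \left\lfloor \frac{2}{3}n(G)\right\rfloor$.
   Context: For a connected graph $G$, $d_G(u,v)$ denotes the length of a shortest $u$–$v$ path. A vertex $w$ distinguishes vertices $u,v$ if $d_G(u,w)\neq d_G(v,w)$. A local resolving set of $G$ is a subset $W\subseteq V(G)$ such that for any two adjacent vertices $u,v\in V(G)\setminus W$ there is a vertex of $W$ distinguishing $u$ and $v$. The local metric dimension $\dim_l(G)$ is the minimum cardinality of a local resolving set of $G$. The clique number $\omega(G)$ is the order of a largest complete subgraph of $G$, and $n(G)=|V(G)|$. *)

theory Defs
  imports "Graph_Theory.Graph_Theory"
begin

text \<open>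
  A finite simple undirected graph is rendered by the locale \<^locale>\<open>graph\<close>, i.e. by a finite
  symmetric digraph without loops and without parallel arcs: each undirected edge is a pair of
  opposite arcs, and adjacency of \<open>u\<close> and \<open>v\<close> is \<open>u \<rightarrow>\<^bsub>G\<^esub> v\<close>.
\<close>

text \<open>Only meaningful if some \<open>u\<close>-\<open>v\<close> path exists; otherwise the value is unspecified.\<close>

definition graph_dist :: "('a, 'b) pre_digraph \<Rightarrow> 'a \<Rightarrow> 'a \<Rightarrow> nat" where
  "graph_dist G u v = (LEAST n. \<exists>p. pre_digraph.apath G u p v \<and> length p = n)"

definition distinguishes :: "('a, 'b) pre_digraph \<Rightarrow> 'a \<Rightarrow> 'a \<Rightarrow> 'a \<Rightarrow> bool" where
  "distinguishes G w u v \<longleftrightarrow> graph_dist G u w \<noteq> graph_dist G v w"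

definition local_resolving_set :: "('a, 'b) pre_digraph \<Rightarrow> 'a set \<Rightarrow> bool" where
  "local_resolving_set G W \<longleftrightarrow>
     W \<subseteq> verts G \<and>
     (\<forall>u \<in> verts G - W. \<forall>v \<in> verts G - W. u \<rightarrow>\<^bsub>G\<^esub> v \<longrightarrow> (\<exists>w \<in> W. distinguishes G w u v))"

definition local_metric_dimension :: "('a, 'b) pre_digraph \<Rightarrow> nat" where
  "local_metric_dimension G = (LEAST k. \<exists>W. local_resolving_set G W \<and> card W = k)"

definition clique_number :: "('a, 'b) pre_digraph \<Rightarrow> nat" where
  "clique_number G = Max {k. \<exists>H. subgraph H G \<and> complete_digraph k H}"

text \<open>The minimum and maximum above are attained for the graphs of interest.\<close>

lemma (in graph) graph_dist_attained:
  assumes "Digraph_Component.connected G" "u \<in> verts G" "v \<in> verts G"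
  shows "\<exists>p. apath u p v \<and> length p = graph_dist G u v"
proof -
  have "u \<rightarrow>\<^sup>*\<^bsub>mk_symmetric G\<^esub> v"
    using assms by (simp add: connected_def strongly_connected_def)
  then have "u \<rightarrow>\<^sup>* v"
    by (simp only: reachable_mk_symmetric_eq[OF sym_arcs])
  then obtain p where p: "apath u p v"
    by (rule exE[OF reachable_apath[THEN iffD1]])
  show ?thesis
    unfolding graph_dist_def by (rule LeastI_ex) (rule exI[of _ "length p"], rule exI[of _ p], simp add: p)
qed

lemma local_resolving_set_verts: "local_resolving_set G (verts G)"
  by (simp add: local_resolving_set_def)

lemma local_metric_dimension_attained:
  "\<exists>W. local_resolving_set G W \<and> card W = local_metric_dimension G"
  unfolding local_metric_dimension_def
  by (rule LeastI_ex) (use local_resolving_set_verts[of G] in blast)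

lemma (in graph) finite_clique_orders: "finite {k. \<exists>H. subgraph H G \<and> complete_digraph k H}"
proof (rule finite_subset)
  show "{k. \<exists>H. subgraph H G \<and> complete_digraph k H} \<subseteq> {..card (verts G)}"
    by (auto simp: complete_digraph_def intro!: card_mono[OF finite_verts] dest: subgraph_imp_subverts)
qed simp

lemma (in graph) clique_number_attained:
  "\<exists>H. subgraph H G \<and> complete_digraph (clique_number G) H"
proof -
  define H where "H = G \<lparr> verts := {}, arcs := {} \<rparr>"
  have "graph H"
    by unfold_locales (simp_all add: H_def symmetric_def arcs_ends_def sym_def)
  then have "complete_digraph 0 H"
    by (simp add: complete_digraph_def H_def arcs_ends_def)
  moreover have "subgraph H G"
    by (simp add: subgraph_def compatible_def H_def wf_digraph_axioms wf_digraph_def)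
  ultimately have "{k. \<exists>H. subgraph H G \<and> complete_digraph k H} \<noteq> {}"
    by blast
  with finite_clique_orders show ?thesis
    unfolding clique_number_def using Max_in[OF finite_clique_orders] by simp
qed

end

theory Submission
  imports Defs
begin

text \<open>
  Only adjacency is used to distinguish vertices. Discharging: pick disjoint sets \<open>A\<close>, \<open>T\<close> with
  \<open>card T \<le> 2 * card A\<close> such that every edge from \<open>A\<close> to the complement of \<open>T\<close> is distinguished
  inside \<open>T\<close>; delete \<open>A \<union> T\<close> and repeat. The vertices \<open>T\<close> deleted so far stay available as
  distinguishing vertices, and the union of all \<open>T\<close> is local resolving.

  Suppose no such pair exists and let \<open>a\<close> be a vertex. Two neighbours \<open>s\<close>, \<open>t\<close> of \<open>a\<close> have a common
  neighbour in \<open>N(a)\<close> (else take \<open>A = {a}\<close>, \<open>T = {s, t}\<close>), and only one: the common neighbours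
  of \<open>{a, s, t}\<close> are independent, so two of them could serve as \<open>A\<close> with \<open>T = {a, s, t}\<close>.
  Hence \<open>N(a) \<inter> N(s)\<close> induces a perfect matching; two of its edges \<open>p1 q1\<close>, \<open>p2 q2\<close> would allow
  \<open>A = {p1, p2}\<close>, \<open>T = {a, s, q1, q2}\<close>. So it is a single edge, and the component of \<open>a\<close> is a
  \<open>K\<^sub>4\<close>. Such a component splits into \<open>2 + 2\<close> as soon as it has a neighbour in the
  deleted \<open>T\<close>, so deletions must not create a \<open>K\<^sub>4\<close> component attached to \<open>A\<close> only; where one would
  arise, some vertices are shifted from \<open>A\<close> to \<open>T\<close>, and the two new \<open>A\<close>-vertices that each
  absorbed \<open>K\<^sub>4\<close> contributes pay for the shift.
\<close>

section \<open>Splittings and their composition\<close>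

locale K5_free =
  fixes E :: "'a \<Rightarrow> 'a \<Rightarrow> bool"
  assumes sym: "E x y \<Longrightarrow> E y x"
    and irrefl: "\<not> E x x"
    and no_K5: "\<lbrakk>E a b; E a c; E a d; E a e; E b c; E b d; E b e; E c d; E c e; E d e\<rbrakk> \<Longrightarrow> False"
begin

text \<open>\<open>X\<close> is what is left of the graph, \<open>Z\<close> the distinguishing vertices already deleted.\<close>

definition splitting :: "'a set \<Rightarrow> 'a set \<Rightarrow> 'a set \<Rightarrow> 'a set \<Rightarrow> bool" where
  "splitting X Z A T \<longleftrightarrow> A \<subseteq> X \<and> T \<subseteq> X \<and> A \<inter> T = {} \<and>
     (\<forall>x\<in>A. \<forall>y\<in>X - T. E x y \<longrightarrow> (\<exists>w\<in>T \<union> Z. E x w \<noteq> E y w))"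

definition K4_component :: "'a set \<Rightarrow> 'a set \<Rightarrow> bool" where
  "K4_component X C \<longleftrightarrow> C \<subseteq> X \<and> card C = 4 \<and> (\<forall>x\<in>C. \<forall>y\<in>X. E x y \<longleftrightarrow> y \<in> C \<and> x \<noteq> y)"

definition attached :: "'a set \<Rightarrow> 'a set \<Rightarrow> bool" where
  "attached C Z \<longleftrightarrow> (\<exists>x\<in>C. \<exists>z\<in>Z. E x z)"

text \<open>In an unattached \<open>K4\<close> component no third vertex of
  \<open>X \<union> Z\<close> tells two of its vertices apart, so it would cost three
  \<open>T\<close>-vertices for one \<open>A\<close>-vertex.\<close>

definition anchored :: "'a set \<Rightarrow> 'a set \<Rightarrow> bool" where
  "anchored X Z \<longleftrightarrow> (\<forall>C. K4_component X C \<longrightarrow> attached C Z)"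

definition reducible :: "'a set \<Rightarrow> 'a set \<Rightarrow> bool" where
  "reducible X Z \<longleftrightarrow> (\<exists>A T. splitting X Z A T \<and> A \<union> T \<noteq> {} \<and> card T \<le> 2 * card A \<and>
     anchored (X - (A \<union> T)) (Z \<union> T))"

lemma sym_iff: "E x y \<longleftrightarrow> E y x"
  using sym by blast

text \<open>An edge from \<open>A'\<close> to \<open>A\<close> is distinguished by the first
  splitting, read from its end in \<open>A\<close>.\<close>

lemma splitting_trans:
  assumes "splitting X Z A T" "splitting (X - (A \<union> T)) (Z \<union> T) A' T'"
  shows "splitting X Z (A \<union> A') (T \<union> T')"
proof -
  have "\<exists>w\<in>T \<union> T' \<union> Z. E x w \<noteq> E y w"
    if x: "x \<in> A \<union> A'" and y: "y \<in> X - (T \<union> T')" and e: "E x y" for x y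
  proof -
    consider "x \<in> A" | "x \<in> A'" "y \<in> A" | "x \<in> A'" "y \<in> X - (A \<union> T) - T'"
      using x y by blast
    then show ?thesis
    proof cases
      case 1
      then show ?thesis using assms(1) y e unfolding splitting_def by blast
    next
      case 2
      have "x \<in> X - T" using 2 assms(2) unfolding splitting_def by blast
      then have "\<exists>w\<in>T \<union> Z. E y w \<noteq> E x w"
        using assms(1) 2 sym[OF e] unfolding splitting_def by blast
      then show ?thesis by blast
    next
      case 3
      then have "\<exists>w\<in>T' \<union> (Z \<union> T). E x w \<noteq> E y w"
        using assms(2) e unfolding splitting_def by blast
      then show ?thesis by blast
    qed
  qed
  moreover have "A \<union> A' \<subseteq> X" "T \<union> T' \<subseteq> X" "(A \<union> A') \<inter> (T \<union> T') = {}"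
    using assms unfolding splitting_def by blast+
  ultimately show ?thesis unfolding splitting_def by blast
qed

lemma splitting_move:
  assumes "splitting X Z A T" "B \<subseteq> A"
  shows "splitting X Z (A - B) (T \<union> B)"
proof -
  have "\<exists>w\<in>(T \<union> B) \<union> Z. E x w \<noteq> E y w" if "x \<in> A - B" "y \<in> X - (T \<union> B)" "E x y" for x y
    using assms(1) that unfolding splitting_def by blast
  then show ?thesis using assms unfolding splitting_def by blast
qed

section \<open>Components \<open>K4\<close> and their absorption\<close>

lemma K4_component_obtain_adj:
  assumes "K4_component X C" "x \<in> C" "y \<in> C" "x \<noteq> y"
  shows "E x y"
  using assms unfolding K4_component_def by blast

text \<open>An outside neighbour of a \<open>K\<^sub>4\<close> misses one of its vertices, so it splits a pair of them.\<close>
lemma splitting_K4_component: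
  assumes C: "K4_component X C" and Z: "attached C Z"
  shows "\<exists>A T. splitting X Z A T \<and> A \<union> T = C \<and> card A = 2 \<and> card T = 2"
proof -
  obtain x z where x: "x \<in> C" "z \<in> Z" "E x z" using Z unfolding attached_def by blast
  have card: "card C = 4" and fin: "finite C"
    using C unfolding K4_component_def by (auto intro: card_ge_0_finite)
  have "\<exists>y\<in>C. \<not> E y z"
  proof (rule ccontr)
    assume "\<not> ?thesis"
    then have all: "E y z" if "y \<in> C" for y using that by blast
    have "\<exists>a b c d. C = {a, b, c, d} \<and> distinct [a, b, c, d]"
      using card by (auto simp: card_Suc_eq numeral_eq_Suc)
    then obtain a b c d where "C = {a, b, c, d}" "distinct [a, b, c, d]" by blast
    then show False
      using no_K5[of a b c d z] all K4_component_obtain_adj[OF C] by simp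
  qed
  then obtain y where y: "y \<in> C" "\<not> E y z" by blast
  have ne: "x \<noteq> y" using x y by blast
  \<comment> \<open>\<open>z\<close> tells \<open>x\<close> from \<open>y\<close>, and within
    \<open>X\<close> the only neighbour of either outside \<open>C - {x, y}\<close> is the other
    one.\<close>
  have "\<exists>w\<in>(C - {x, y}) \<union> Z. E u w \<noteq> E v w"
    if "u \<in> {x, y}" "v \<in> X - (C - {x, y})" "E u v" for u v
  proof -
    have "v \<in> {x, y}" "v \<noteq> u" using C that x y unfolding K4_component_def by blast+
    then show ?thesis using that(1) x y by blast
  qed
  then have "splitting X Z {x, y} (C - {x, y})"
    using C x y unfolding splitting_def K4_component_def by blast
  moreover have "card (C - {x, y}) = 2"
    using card x y ne fin by (simp add: card_Diff_subset)
  ultimately show ?thesis using ne x y by (intro exI[of _ "{x, y}"] exI[of _ "C - {x, y}"]) auto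
qed

lemma K4_component_Diff:
  assumes "K4_component X C" "C \<inter> D = {}"
  shows "K4_component (X - D) C"
  using assms unfolding K4_component_def by blast

lemma K4_component_iff:
  assumes "K4_component X C" "x \<in> C"
  shows "y \<in> C \<longleftrightarrow> y = x \<or> y \<in> X \<and> E x y"
  using assms unfolding K4_component_def by (metis subsetD)

lemma K4_component_disjoint:
  assumes C: "K4_component X C" and D: "K4_component X D" and ne: "C \<noteq> D"
  shows "C \<inter> D = {}"
  using K4_component_iff[OF C] K4_component_iff[OF D] ne by (metis disjoint_iff set_eqI)

text \<open>No edge of \<open>X\<close> leaves \<open>C\<close>, so deleting \<open>C\<close> cannot
  isolate a new \<open>K4\<close>.\<close>

lemma K4_component_remove:
  assumes C: "K4_component X C" and D: "K4_component (X - C) D"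
  shows "K4_component X D"
proof -
  have sub: "D \<subseteq> X - C" using D unfolding K4_component_def by blast
  have "\<not> E x y" if "x \<in> D" "y \<in> C" for x y
    using K4_component_iff[OF C that(2), of x] sub that sym by blast
  moreover have "E x y \<longleftrightarrow> y \<in> D \<and> x \<noteq> y" if "x \<in> D" "y \<in> X - C" for x y
    using D that unfolding K4_component_def by blast
  ultimately have "\<forall>x\<in>D. \<forall>y\<in>X. E x y \<longleftrightarrow> y \<in> D \<and> x \<noteq> y"
    using sub by blast
  then show ?thesis using D sub unfolding K4_component_def by blast
qed

lemma anchored_mono: "anchored X Z \<Longrightarrow> Z \<subseteq> Z' \<Longrightarrow> anchored X Z'"
  unfolding anchored_def attached_def by blast

lemma anchored_remove:
  "anchored X Z \<Longrightarrow> K4_component X C \<Longrightarrow> anchored (X - C) Z"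
  using K4_component_remove unfolding anchored_def by blast

text \<open>The slack \<open>2 * card A - card T\<close> grows by 2 with each absorption, whereas
  shifting a vertex from \<open>A\<close> to \<open>T\<close> costs 3.\<close>

lemma splitting_absorb:
  assumes s: "splitting X Z A T" and an: "anchored (X - (A \<union> T)) (Z \<union> T)"
    and C: "K4_component (X - (A \<union> T)) C" and fin: "finite X"
  shows "\<exists>A' T'. splitting X Z A' T' \<and> A' \<union> T' = A \<union> T \<union> C \<and> card A' = card A + 2 \<and>
     card T' = card T + 2 \<and> anchored (X - (A' \<union> T')) (Z \<union> T')"
proof -
  obtain A1 T1 where 1: "splitting (X - (A \<union> T)) (Z \<union> T) A1 T1" "A1 \<union> T1 = C"
      "card A1 = 2" "card T1 = 2"
    using splitting_K4_component[OF C] an C unfolding anchored_def by blast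
  have fins: "finite A" "finite T" "finite A1" "finite T1"
    using s 1 fin unfolding splitting_def by (meson finite_Diff finite_subset)+
  have disj: "A \<inter> A1 = {}" "T \<inter> T1 = {}"
    using 1 unfolding splitting_def by blast+
  have eq: "A \<union> A1 \<union> (T \<union> T1) = A \<union> T \<union> C" using 1 by blast
  have "X - (A \<union> T) - C = X - (A \<union> T \<union> C)" by blast
  then have "anchored (X - (A \<union> T \<union> C)) (Z \<union> (T \<union> T1))"
    using anchored_mono[OF anchored_remove[OF an C], of "Z \<union> (T \<union> T1)"] by force
  moreover have "card (A \<union> A1) = card A + 2" "card (T \<union> T1) = card T + 2"
    using 1(3,4) disj fins by (simp_all add: card_Un_disjoint)
  ultimately show ?thesis
    using splitting_trans[OF s 1(1)] eq by metis
qed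

section \<open>Cut vertices\<close>

text \<open>For anchored \<open>X\<close>, such a \<open>v\<close> is the only vertex of
  \<open>(X - C) \<union> Z\<close> to which some \<open>K4\<close> on a set \<open>C\<close> is
  adjacent.\<close>

definition cuttable :: "'a set \<Rightarrow> 'a set \<Rightarrow> bool" where
  "cuttable X Z \<longleftrightarrow> (\<exists>v\<in>X. \<not> anchored (X - {v}) Z)"

text \<open>Putting the cut vertex \<open>v\<close> into \<open>T\<close> keeps everything anchored,
  since a component of \<open>X - {v}\<close> not adjacent to \<open>v\<close> is already one of
  \<open>X\<close>. Absorbing \<open>C\<close> turns the slack from -1 to 1.\<close>

lemma reducible_if_cuttable:
  assumes an: "anchored X Z" and cut: "cuttable X Z" and fin: "finite X"
  shows "reducible X Z"
proof -
  obtain v C where v: "v \<in> X" and C: "K4_component (X - {v}) C" "\<not> attached C Z"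
    using cut unfolding cuttable_def anchored_def by blast
  have s: "splitting X Z {} {v}" using v unfolding splitting_def by blast
  have "anchored (X - ({} \<union> {v})) (Z \<union> {v})"
    unfolding anchored_def
  proof (intro allI impI, rule ccontr)
    fix D assume D: "K4_component (X - ({} \<union> {v})) D" and "\<not> attached D (Z \<union> {v})"
    then have na: "\<not> attached D Z" "\<forall>x\<in>D. \<not> E x v" unfolding attached_def by auto
    then have "K4_component X D" using D unfolding K4_component_def by blast
    then show False using an na unfolding anchored_def by blast
  qed
  from splitting_absorb[OF s this _ fin, of C] C(1)
  obtain A T where AT: "splitting X Z A T" "A \<union> T = insert v C" "card A = 2" "card T = 3"
     "anchored (X - (A \<union> T)) (Z \<union> T)" by auto
  then show ?thesis unfolding reducible_def by (intro exI[of _ A] exI[of _ T]) auto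
qed

text \<open>A newly created component that lost all its anchors hung on at least two vertices of \<open>A\<close>.\<close>
lemma unanchored_attached:
  assumes an: "anchored X Z" and ncut: "\<not> cuttable X Z" and s: "splitting X Z A T"
    and C: "K4_component (X - (A \<union> T)) C" "\<not> attached C (Z \<union> T)" and a: "a \<in> A"
  shows "attached C (A - {a})"
proof (rule ccontr)
  assume na: "\<not> attached C (A - {a})"
  then have "K4_component (X - {a}) C"
    using C a unfolding K4_component_def attached_def by blast
  moreover have "a \<in> X" using a s unfolding splitting_def by blast
  ultimately have "attached C Z" using ncut unfolding cuttable_def anchored_def by blast
  then show False using C unfolding attached_def by blast
qed

text \<open>A new unanchored component would have to hang on \<open>A - {a}\<close>, which is empty
  here.\<close>

lemma anchored_singleton:
  assumes "anchored X Z" "\<not> cuttable X Z" "splitting X Z {a} T"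
  shows "anchored (X - ({a} \<union> T)) (Z \<union> T)"
  using unanchored_attached[OF assms, of _ a] unfolding anchored_def attached_def by blast

lemma reducible_singleton:
  assumes "anchored X Z" "\<not> cuttable X Z" "splitting X Z {a} T" "card T \<le> 2"
  shows "reducible X Z"
  using anchored_singleton[OF assms(1-3)] assms(3,4) unfolding reducible_def
  by (intro exI[of _ "{a}"] exI[of _ T]) auto

section \<open>Common neighbourhoods in an irreducible graph\<close>

text \<open>A vertex not adjacent to some member of \<open>B\<close> is told apart from every vertex
  of \<open>A\<close> by that member.\<close>

lemma splitting_common_neighbours:
  assumes "A \<subseteq> X" "T \<subseteq> X" "A \<inter> T = {}" "\<forall>x\<in>A. \<forall>t\<in>B. E x t" "B \<subseteq> T"
    "\<forall>x\<in>A. \<forall>y\<in>X - T. (\<forall>t\<in>B. E y t) \<longrightarrow> \<not> E x y"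
  shows "splitting X Z A T"
proof -
  have "\<exists>w\<in>T \<union> Z. E x w \<noteq> E y w" if xy: "x \<in> A" "y \<in> X - T" "E x y" for x y
  proof -
    have "\<not> (\<forall>t\<in>B. E y t)" using assms(6) xy by metis
    then obtain t where "t \<in> B" "\<not> E y t" by blast
    then show ?thesis using assms(4,5) xy(1) by blast
  qed
  then show ?thesis using assms(1-3) unfolding splitting_def by simp
qed

lemma common_neighbour:
  assumes an: "anchored X Z" "\<not> cuttable X Z" and nr: "\<not> reducible X Z"
    and a: "a \<in> X" and T: "T \<subseteq> X" "card T \<le> 2" "\<forall>t\<in>T. E a t"
  shows "\<exists>y\<in>X. E a y \<and> (\<forall>t\<in>T. E y t)"
proof (rule ccontr)
  assume "\<not> ?thesis"
  then have "splitting X Z {a} T"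
    using a T irrefl by (intro splitting_common_neighbours[where B = T]) auto
  then show False using reducible_singleton an nr T by blast
qed

lemma common_neighbour_of_pair:
  assumes an: "anchored X Z" "\<not> cuttable X Z" and nr: "\<not> reducible X Z"
    and X: "a \<in> X" "s \<in> X" "t \<in> X" and E: "E a s" "E a t"
  obtains y where "y \<in> X" "E a y" "E s y" "E t y"
proof -
  have "card {s, t} \<le> 2" by (simp add: card_insert_if)
  then obtain y where "y \<in> X" "E a y" "E y s" "E y t"
    using common_neighbour[OF an nr X(1), of "{s, t}"] X E by blast
  then show thesis using that sym by blast
qed

text \<open>
  If \<open>{p, q}\<close>, \<open>T\<close> cuts off an unanchored \<open>K\<^sub>4\<close>, shifting \<open>p\<close> to \<open>T\<close> anchors it, and absorbing it
  gives the sizes \<open>3\<close> and \<open>6\<close>.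
\<close>

lemma independent_common_neighbours_unique:
  assumes an: "anchored X Z" "\<not> cuttable X Z" and nr: "\<not> reducible X Z" and fin: "finite X"
    and T: "T \<subseteq> X" "card T = 3" and p: "p \<in> X" "\<forall>t\<in>T. E p t" and q: "q \<in> X" "\<forall>t\<in>T. E q t"
    and ind: "\<And>u v. u \<in> X \<Longrightarrow> v \<in> X \<Longrightarrow> \<forall>t\<in>T. E u t \<Longrightarrow> \<forall>t\<in>T. E v t \<Longrightarrow> \<not> E u v"
  shows "p = q"
proof (rule ccontr)
  assume ne: "p \<noteq> q"
  have nT: "p \<notin> T" "q \<notin> T" using p q irrefl by blast+
  have finT: "finite T" using T fin finite_subset by blast
  have s: "splitting X Z {p, q} T"
    using T p q nT ind by (intro splitting_common_neighbours[where B = T]) auto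
  show False
  proof (cases "anchored (X - ({p, q} \<union> T)) (Z \<union> T)")
    case True
    then have "reducible X Z" unfolding reducible_def
      using s ne T by (intro exI[of _ "{p, q}"] exI[of _ T]) auto
    then show False using nr by blast
  next
    case False
    then obtain C where C: "K4_component (X - ({p, q} \<union> T)) C" unfolding anchored_def by blast
    have s': "splitting X Z {q} (insert p T)"
      using splitting_move[OF s, of "{p}"] ne by (simp add: insert_Diff_if)
    have eq: "{q} \<union> insert p T = {p, q} \<union> T" by blast
    obtain A' T' where "splitting X Z A' T'" "A' \<union> T' = {p, q} \<union> T \<union> C" "card A' = 3"
        "card T' = 6" "anchored (X - (A' \<union> T')) (Z \<union> T')"
      using splitting_absorb[OF s' anchored_singleton[OF an s'], of C] C fin T(2) nT finT
      unfolding eq by auto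
    then have "reducible X Z" unfolding reducible_def
      by (intro exI[of _ A'] exI[of _ T']) auto
    then show False using nr by blast
  qed
qed

text \<open>For adjacent \<open>s\<close>, \<open>t\<close> the common neighbours of the triangle
  are independent, as there is no \<open>K5\<close>. In general, adjacent common neighbours
  \<open>u\<close>, \<open>v\<close> of \<open>a, s, t\<close> would give the triangle
  \<open>a, u, v\<close> two common neighbours \<open>s\<close> and \<open>t\<close>.\<close>

lemma common_neighbour_unique:
  assumes an: "anchored X Z" "\<not> cuttable X Z" and nr: "\<not> reducible X Z" and fin: "finite X"
    and X: "a \<in> X" "s \<in> X" "t \<in> X" "p \<in> X" "q \<in> X" and E: "E a s" "E a t" "s \<noteq> t"
    and p: "E a p" "E s p" "E t p" and q: "E a q" "E s q" "E t q"
  shows "p = q"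
proof -
  have clique: "p = q" if X: "a \<in> X" "s \<in> X" "t \<in> X" "p \<in> X" "q \<in> X"
    and E: "E a s" "E a t" "E s t"
    and p: "E a p" "E s p" "E t p" and q: "E a q" "E s q" "E t q" for a s t p q
  proof (rule independent_common_neighbours_unique[OF an nr fin, where T = "{a, s, t}"])
    show "card {a, s, t} = 3" using E irrefl by (auto simp: card_insert_if)
    fix u v assume "\<forall>t\<in>{a, s, t}. E u t" "\<forall>t\<in>{a, s, t}. E v t"
    then show "\<not> E u v" using no_K5[of a s t u v] E sym by blast
  qed (use X p q sym in blast)+
  show ?thesis
  proof (rule independent_common_neighbours_unique[OF an nr fin, where T = "{a, s, t}"])
    show "card {a, s, t} = 3" using E irrefl by (auto simp: card_insert_if)
    fix u v assume uv: "u \<in> X" "v \<in> X" "\<forall>t\<in>{a, s, t}. E u t" "\<forall>t\<in>{a, s, t}. E v t"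
    show "\<not> E u v"
    proof
      assume "E u v"
      then have "s = t" using clique[of a u v s t] X E uv sym by blast
      then show False using E by blast
    qed
  qed (use X p q sym in blast)+
qed

text \<open>
  If both \<open>A = {p1, p2}\<close> and \<open>A = {q1, q2}\<close> cut off an unanchored \<open>K\<^sub>4\<close>, these are two different
  components, and shifting \<open>p1\<close> to \<open>T\<close> allows to absorb both: sizes \<open>1 + 4\<close> and \<open>5 + 4\<close>.
\<close>

lemma two_edges_in_common_neighbourhood:
  assumes an: "anchored X Z" "\<not> cuttable X Z" and nr: "\<not> reducible X Z" and fin: "finite X"
    and X: "{a, s, p1, q1, p2, q2} \<subseteq> X" and dist: "distinct [a, s, p1, q1, p2, q2]"
    and adj: "\<forall>x\<in>{p1, q1, p2, q2}. E a x \<and> E s x"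
    and match: "\<And>x y. {x, y} = {p1, q1} \<or> {x, y} = {p2, q2} \<Longrightarrow> x \<noteq> y \<Longrightarrow>
      \<forall>z\<in>X. E a z \<longrightarrow> E s z \<longrightarrow> E x z \<longrightarrow> z = y"
  shows False
proof -
  \<comment> \<open>One end of each edge goes into \<open>A\<close>. By \<open>match\<close>, its
    only neighbour among the common neighbours of \<open>a\<close> and \<open>s\<close> is its
    partner, which lies in \<open>T\<close>.\<close>
  have split: "splitting X Z {x, y} {a, s, x', y'}"
    if xy: "{x, x'} = {p1, q1}" "{y, y'} = {p2, q2}" "distinct [a, s, x, x', y, y']" for x y x' y'
  proof (rule splitting_common_neighbours[where B = "{a, s}"])
    have mem: "{x, x', y, y'} = {p1, q1, p2, q2}" using xy by blast
    then show "{x, y} \<subseteq> X" "{a, s, x', y'} \<subseteq> X" using X by blast+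
    show "{x, y} \<inter> {a, s, x', y'} = {}" using xy(3) by auto
    show "\<forall>x\<in>{x, y}. \<forall>t\<in>{a, s}. E x t" using mem adj sym by blast
    show "\<forall>u\<in>{x, y}. \<forall>v\<in>X - {a, s, x', y'}. (\<forall>t\<in>{a, s}. E v t) \<longrightarrow> \<not> E u v"
    proof (intro ballI impI notI)
      fix u v assume u: "u \<in> {x, y}" and v: "v \<in> X - {a, s, x', y'}" "\<forall>t\<in>{a, s}. E v t" "E u v"
      have "E a v" "E s v" using v sym by blast+
      moreover have "x \<noteq> x'" "y \<noteq> y'" using xy(3) by auto
      ultimately have "v = x' \<or> v = y'"
        using match[of x x'] match[of y y'] u v(1,3) xy(1,2) by blast
      then show False using v(1) by blast
    qed
  qed blast
  have s: "splitting X Z {p1, p2} {a, s, q1, q2}" "splitting X Z {q1, q2} {a, s, p1, p2}"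
    by (rule split; use dist in auto)+
  have S: "{p1, p2} \<union> {a, s, q1, q2} = {a, s, p1, q1, p2, q2}"
    "{q1, q2} \<union> {a, s, p1, p2} = {a, s, p1, q1, p2, q2}" 
    "{p2} \<union> {a, s, p1, q1, q2} = {a, s, p1, q1, p2, q2}" by blast+
  let ?S = "{a, s, p1, q1, p2, q2}"
  \<comment> \<open>Sizes 2 and 4 meet the bound exactly, so only a loss of anchoring can prevent a
    reduction.\<close>
  have "\<not> anchored (X - ?S) (Z \<union> {a, s, q1, q2})"
  proof
    assume "anchored (X - ?S) (Z \<union> {a, s, q1, q2})"
    then have "reducible X Z" unfolding reducible_def
      using s dist S by (intro exI[of _ "{p1, p2}"] exI[of _ "{a, s, q1, q2}"]) (simp add: S)
    then show False using nr by blast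
  qed
  then obtain C where C: "K4_component (X - ?S) C" "\<not> attached C (Z \<union> {a, s, q1, q2})"
    unfolding anchored_def by blast
  have "\<not> anchored (X - ?S) (Z \<union> {a, s, p1, p2})"
  proof
    assume "anchored (X - ?S) (Z \<union> {a, s, p1, p2})"
    then have "reducible X Z" unfolding reducible_def
      using s dist S by (intro exI[of _ "{q1, q2}"] exI[of _ "{a, s, p1, p2}"]) (simp add: S)
    then show False using nr by blast
  qed
  then obtain D where D: "K4_component (X - ?S) D" "\<not> attached D (Z \<union> {a, s, p1, p2})"
    unfolding anchored_def by blast
  \<comment> \<open>\<open>C\<close> hangs on \<open>p2\<close>, to which \<open>D\<close> is not
    adjacent.\<close>
  have "attached C {p2}"
    using unanchored_attached[OF an s(1), of C p1] C dist S(1) by (simp add: insert_Diff_if split: if_splits)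
  then have "C \<noteq> D" using D unfolding attached_def by blast
  then have disj: "D \<inter> C = {}" using K4_component_disjoint C D by blast
  have s': "splitting X Z {p2} {a, s, p1, q1, q2}"
    using splitting_move[OF s(1), of "{p1}"] dist
    by (simp add: insert_Diff_if insert_commute split: if_splits)
  \<comment> \<open>Sizes 3 and 7 still miss the bound by 1; absorbing \<open>D\<close> as well
    repairs this.\<close>
  obtain A T where AT: "splitting X Z A T" "A \<union> T = ?S \<union> C" "card A = 3"
      "card T = 7" "anchored (X - (A \<union> T)) (Z \<union> T)"
    using splitting_absorb[OF s' anchored_singleton[OF an s'], of C] C fin dist
    unfolding S by auto
  have "X - ?S - C = X - (A \<union> T)" using AT(2) by blast
  then have "K4_component (X - (A \<union> T)) D"
    using K4_component_Diff[OF D(1) disj] by metis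
  from splitting_absorb[OF AT(1,5) this fin] AT
  obtain A' T' where "splitting X Z A' T'" "A' \<union> T' = ?S \<union> C \<union> D" "card A' = 5"
      "card T' = 9" "anchored (X - (A' \<union> T')) (Z \<union> T')"
    by auto
  then have "reducible X Z" unfolding reducible_def
    by (intro exI[of _ A'] exI[of _ T']) auto
  then show False using nr by blast
qed

text \<open>A further vertex \<open>r\<close> has a partner \<open>r'\<close> in the common
  neighbourhood; uniqueness keeps \<open>r'\<close> off \<open>p\<close> and \<open>q\<close>, so a
  second disjoint edge arises.\<close>

lemma common_neighbours_edge:
  assumes an: "anchored X Z" "\<not> cuttable X Z" and nr: "\<not> reducible X Z" and fin: "finite X"
    and X: "a \<in> X" "s \<in> X" "p \<in> X" "q \<in> X" "r \<in> X" 
    and E: "E a s" "E a p" "E a q" "E s p" "E s q" "E p q" "E a r" "E s r"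
  shows "r = p \<or> r = q"
proof (rule ccontr)
  assume r: "\<not> ?thesis"
  have uniq: "u = v" if "E a x" "E s x" "x \<in> X" "u \<in> X" "v \<in> X" "E a u" "E s u" "E x u"
     "E a v" "E s v" "E x v" for x u v
    using common_neighbour_unique[OF an nr fin, of a s x u v] that X E irrefl by blast
  obtain r' where r': "r' \<in> X" "E a r'" "E s r'" "E r r'"
    using common_neighbour_of_pair[OF an nr X(1,2,5) E(1,7)] by blast
  have "r' \<noteq> p" using uniq[of p q r] r' r X E sym by blast
  moreover have "r' \<noteq> q" using uniq[of q p r] r' r X E sym by blast
  ultimately have dist: "distinct [a, s, p, q, r, r']" using E r r' irrefl by auto
  show False
  proof (rule two_edges_in_common_neighbourhood[OF an nr fin, of a s p q r r'])
    fix x y assume "{x, y} = {p, q} \<or> {x, y} = {r, r'}" "x \<noteq> y"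
    then have "x = p \<and> y = q \<or> x = q \<and> y = p \<or> x = r \<and> y = r' \<or> x = r' \<and> y = r"
      by (auto simp: doubleton_eq_iff)
    then have "x \<in> X" "E a x" "E s x" "y \<in> X" "E a y" "E s y" "E x y"
      using X E r' sym by blast+
    then show "\<forall>z\<in>X. E a z \<longrightarrow> E s z \<longrightarrow> E x z \<longrightarrow> z = y" using uniq by blast
  qed (use X E r' dist in auto)
qed

text \<open>\<open>y\<close> and \<open>s\<close> have a common neighbour in \<open>N(a)\<close>,
  which must be \<open>p\<close> or \<open>q\<close>. Then \<open>y\<close> is a common neighbour of
  the ends of the edge \<open>a p\<close> or \<open>a q\<close>, hence in the
  \<open>K4\<close>.\<close>

lemma neighbours_in_K4:
  assumes an: "anchored X Z" "\<not> cuttable X Z" and nr: "\<not> reducible X Z" and fin: "finite X"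
    and X: "a \<in> X" "s \<in> X" "p \<in> X" "q \<in> X" "y \<in> X" 
    and E: "E a s" "E a p" "E a q" "E s p" "E s q" "E p q" "E a y"
  shows "y \<in> {s, p, q}"
proof (rule ccontr)
  assume y: "y \<notin> {s, p, q}"
  obtain z where z: "z \<in> X" "E a z" "E s z" "E y z"
    using common_neighbour_of_pair[OF an nr X(1,2,5) E(1,7)] by blast
  have "z = p \<or> z = q"
    using common_neighbours_edge[OF an nr fin, of a s p q z] X E z sym by blast
  then show False
    using common_neighbours_edge[OF an nr fin, of a p s q y]
      common_neighbours_edge[OF an nr fin, of a q s p y] X E z y sym by blast
qed

section \<open>Existence of a reduction, and induction\<close>

lemma anchored_reducible:
  assumes an: "anchored X Z" and fin: "finite X" and ne: "X \<noteq> {}"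
  shows "reducible X Z"
proof (rule ccontr)
  assume nr: "\<not> reducible X Z"
  have an: "anchored X Z" "\<not> cuttable X Z"
    using reducible_if_cuttable an fin nr by blast+
  obtain a where a: "a \<in> X" using ne by blast
  \<comment> \<open>\<open>T = {}\<close> yields a neighbour of \<open>a\<close>; the degenerate
    pair \<open>s\<close>, \<open>s\<close> then yields a triangle.\<close>
  obtain s where s: "s \<in> X" "E a s" using common_neighbour[OF an nr a, of "{}"] by auto
  obtain p where p: "p \<in> X" "E a p" "E s p"
    using common_neighbour_of_pair[OF an nr a s(1) s(1) s(2) s(2)] by blast
  obtain q where q: "q \<in> X" "E a q" "E s q" "E p q"
    using common_neighbour_of_pair[OF an nr a s(1) p(1) s(2) p(2)] by blast
  let ?C = "{a, s, p, q}"
  have clique: "E x y" if "x \<in> ?C" "y \<in> ?C" "x \<noteq> y" for x y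
    using that s p q sym by blast
  have dist: "distinct [a, s, p, q]" using s p q irrefl by auto
  have closed: "y \<in> ?C" if "x \<in> ?C" "y \<in> X" "E x y" for x y
    using neighbours_in_K4[OF an nr fin, of a s p q y] neighbours_in_K4[OF an nr fin, of s a p q y]
      neighbours_in_K4[OF an nr fin, of p a s q y] neighbours_in_K4[OF an nr fin, of q a s p y]
      that a s p q sym by blast
  have C: "K4_component X ?C"
    unfolding K4_component_def
  proof (intro conjI ballI iffI)
    show "?C \<subseteq> X" "card ?C = 4" using a s p q dist by simp_all
  next
    fix x y assume xy: "x \<in> ?C" "y \<in> X"
    show "y \<in> ?C" if "E x y" using closed[OF xy that] .
    show "x \<noteq> y" if "E x y" using irrefl that by blast
    show "E x y" if "y \<in> ?C \<and> x \<noteq> y" using clique[OF xy(1)] that by blast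
  qed
  \<comment> \<open>The empty splitting absorbs the whole \<open>K4\<close>, with sizes 2 and
    2.\<close>
  have s0: "splitting X Z {} {}" unfolding splitting_def by blast
  obtain A T where "splitting X Z A T" "A \<union> T = ?C" "card A = 2" "card T = 2"
     "anchored (X - (A \<union> T)) (Z \<union> T)"
    using splitting_absorb[OF s0, of ?C] an(1) C fin by auto
  then have "reducible X Z"
    unfolding reducible_def by (intro exI[of _ A] exI[of _ T]) auto
  then show False using nr by blast
qed

text \<open>Reductions are iterated with the deleted \<open>T\<close> passed on into
  \<open>Z\<close>; each one preserves anchoring, and the bounds add up.\<close>

theorem splitting_exists:
  assumes "finite X" "anchored X Z"
  shows "\<exists>A T. splitting X Z A T \<and> A \<union> T = X \<and> card T \<le> 2 * card A"
  using assms
proof (induction "card X" arbitrary: X Z rule: less_induct)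
  case less
  show ?case
  proof (cases "X = {}")
    case True
    then show ?thesis unfolding splitting_def by (intro exI[of _ "{}"]) auto
  next
    case False
    then obtain A T where AT: "splitting X Z A T" "A \<union> T \<noteq> {}" "card T \<le> 2 * card A"
        "anchored (X - (A \<union> T)) (Z \<union> T)"
      using anchored_reducible less.prems unfolding reducible_def by blast
    have sub: "A \<union> T \<subseteq> X" using AT unfolding splitting_def by blast
    then have "card (X - (A \<union> T)) < card X"
      using AT(2) less.prems(1) by (intro psubset_card_mono) auto
    then obtain A' T' where AT': "splitting (X - (A \<union> T)) (Z \<union> T) A' T'"
        "A' \<union> T' = X - (A \<union> T)" "card T' \<le> 2 * card A'"
      using less.hyps AT(4) less.prems(1) by blast
    have fins: "finite A" "finite A'" "finite T" "finite T'"
      using sub AT'(1) less.prems(1) unfolding splitting_def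
      by (auto intro: finite_subset[OF _ less.prems(1)])
    have "A \<inter> A' = {}" using AT'(2) by blast
    then have "card (T \<union> T') \<le> 2 * card (A \<union> A')"
      using card_Un_le[of T T'] AT(3) AT'(3) fins by (simp add: card_Un_disjoint)
    moreover have "A \<union> A' \<union> (T \<union> T') = X" using sub AT'(2) by blast
    ultimately show ?thesis using splitting_trans[OF AT(1) AT'(1)] by blast
  qed
qed

end

section \<open>Distances, cliques and connectivity of the graph\<close>

context graph
begin

lemma graph_dist_eq_1_iff:
  assumes conn: "Digraph_Component.connected G" and uv: "u \<in> verts G" "v \<in> verts G" "u \<noteq> v"
  shows "graph_dist G u v = 1 \<longleftrightarrow> u \<rightarrow>\<^bsub>G\<^esub> v"
proof
  assume "u \<rightarrow>\<^bsub>G\<^esub> v"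
  then obtain e where e: "e \<in> arcs G" "tail G e = u" "head G e = v" by (rule reachableE)
  have path: "apath u [e] v" using e uv by (simp add: apath_simps)
  show "graph_dist G u v = 1"
    unfolding graph_dist_def
  proof (rule Least_equality)
    show "\<exists>p. apath u p v \<and> length p = 1" using path by (intro exI[of _ "[e]"]) simp
    fix n assume "\<exists>p. apath u p v \<and> length p = n"
    then obtain p where "apath u p v" "length p = n" by blast
    then show "1 \<le> n" using uv(3) by (cases p) (auto simp: apath_simps)
  qed
next
  assume d: "graph_dist G u v = 1"
  obtain p where p: "apath u p v" "length p = 1" using graph_dist_attained[OF conn uv(1,2)] d by auto
  then obtain e where "p = [e]" by (auto simp: length_Suc_conv)
  then have "e \<in> arcs G" "tail G e = u" "head G e = v" using p(1) by (auto simp: apath_simps)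
  then show "u \<rightarrow>\<^bsub>G\<^esub> v" by (auto simp: arcs_ends_conv)
qed

lemma clique_card_le_clique_number:
  assumes S: "S \<subseteq> verts G" and clique: "\<And>u v. u \<in> S \<Longrightarrow> v \<in> S \<Longrightarrow> u \<noteq> v \<Longrightarrow> u \<rightarrow>\<^bsub>G\<^esub> v"
  shows "card S \<le> clique_number G"
proof -
  have ind: "induced_subgraph (G \<restriction> S) G" using S by (rule induced_induce)
  have "digraph (G \<restriction> S)" by (rule digraphI_induced[OF ind])
  moreover have "symmetric (G \<restriction> S)" by (rule induced_graph_imp_symmetric[OF sym_arcs ind])
  ultimately have "graph (G \<restriction> S)" by (rule digraph.graphI)
  moreover have "arcs_ends (G \<restriction> S) = {(u, v). (u, v) \<in> S \<times> S \<and> u \<noteq> v}"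
  proof (intro equalityI subsetI)
    fix x assume "x \<in> arcs_ends (G \<restriction> S)"
    then show "x \<in> {(u, v). (u, v) \<in> S \<times> S \<and> u \<noteq> v}"
      using no_loops by (auto simp: arcs_ends_conv)
  next
    fix x assume "x \<in> {(u, v). (u, v) \<in> S \<times> S \<and> u \<noteq> v}"
    then obtain u v where x: "x = (u, v)" "u \<in> S" "v \<in> S" "u \<noteq> v" by blast
    obtain e where "e \<in> arcs G" "tail G e = u" "head G e = v"
      using clique[OF x(2-4)] by (rule reachableE)
    then show "x \<in> arcs_ends (G \<restriction> S)" using x by (force simp: arcs_ends_conv)
  qed
  ultimately have "complete_digraph (card S) (G \<restriction> S)" by (simp add: complete_digraph_def)
  then show ?thesis unfolding clique_number_def
    using induced_imp_subgraph[OF ind] by (intro Max_ge[OF finite_clique_orders]) blast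
qed

lemma K5_free_dominates:
  assumes "clique_number G = 4"
  shows "K5_free (dominates G)"
proof
  show "v \<rightarrow>\<^bsub>G\<^esub> u" if "u \<rightarrow>\<^bsub>G\<^esub> v" for u v using arcs_ends_symmetric[OF sym_arcs that] .
  show irrefl: "\<not> u \<rightarrow>\<^bsub>G\<^esub> u" for u using adj_not_same by blast
  fix a b c d e
  assume adj: "a \<rightarrow>\<^bsub>G\<^esub> b" "a \<rightarrow>\<^bsub>G\<^esub> c" "a \<rightarrow>\<^bsub>G\<^esub> d" "a \<rightarrow>\<^bsub>G\<^esub> e" "b \<rightarrow>\<^bsub>G\<^esub> c"
    "b \<rightarrow>\<^bsub>G\<^esub> d" "b \<rightarrow>\<^bsub>G\<^esub> e" "c \<rightarrow>\<^bsub>G\<^esub> d" "c \<rightarrow>\<^bsub>G\<^esub> e" "d \<rightarrow>\<^bsub>G\<^esub> e"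
  have "distinct [a, b, c, d, e]" using adj irrefl by auto
  then have "card {a, b, c, d, e} = 5" by simp
  moreover have "card {a, b, c, d, e} \<le> clique_number G"
  proof (rule clique_card_le_clique_number)
    show "{a, b, c, d, e} \<subseteq> verts G" using adj adj_in_verts by blast
    show "u \<rightarrow>\<^bsub>G\<^esub> v" if "u \<in> {a, b, c, d, e}" "v \<in> {a, b, c, d, e}" "u \<noteq> v" for u v
      using that adj adj[THEN arcs_ends_symmetric[OF sym_arcs]] by blast
  qed
  ultimately show False using assms by simp
qed

lemma connected_closed_subset:
  assumes conn: "Digraph_Component.connected G" and c: "c \<in> C" "C \<subseteq> verts G"
    and closed: "\<And>u v. u \<in> C \<Longrightarrow> u \<rightarrow>\<^bsub>G\<^esub> v \<Longrightarrow> v \<in> C"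
  shows "C = verts G"
proof -
  have "v \<in> C" if "v \<in> verts G" for v
  proof -
    have "c \<rightarrow>\<^sup>*\<^bsub>mk_symmetric G\<^esub> v"
      using conn c that by (auto simp: connected_def strongly_connected_def)
    then have "c \<rightarrow>\<^sup>*\<^bsub>G\<^esub> v"
      by (simp only: reachable_mk_symmetric_eq[OF sym_arcs])
    then show ?thesis
      by (induction rule: reachable_induct) (use c closed in auto)
  qed
  then show ?thesis using c by blast
qed

end

theorem theorem1:
  fixes G :: "('a, 'b) pre_digraph"
  assumes "Digraph.graph G"
    and "Digraph_Component.connected G"
    and "card (verts G) \<ge> 5"
    and "clique_number G = 4"
  shows "int (local_metric_dimension G) \<le> \<lfloor>2 / 3 * real (card (verts G))\<rfloor>"
proof -
  interpret graph G by fact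
  interpret K5_free "dominates G" by (rule K5_free_dominates) fact
  \<comment> \<open>A \<open>K4\<close> component would be all of the connected graph, which has at
    least 5 vertices, so anchoring holds vacuously at the start.\<close>
  have "anchored (verts G) {}"
    unfolding anchored_def
  proof (intro allI impI)
    fix C assume C: "K4_component (verts G) C"
    then have card: "card C = 4" and sub: "C \<subseteq> verts G" unfolding K4_component_def by blast+
    then obtain c where c: "c \<in> C" by fastforce
    have "v \<in> C" if "u \<in> C" "u \<rightarrow>\<^bsub>G\<^esub> v" for u v
      using K4_component_iff[OF C that(1), of v] that(2) adj_in_verts(2)[OF that(2)] by blast
    then have "C = verts G" by (rule connected_closed_subset[OF assms(2) c sub])
    then show "attached C {}" using card assms(3) by simp
  qed
  then obtain A T where AT: "splitting (verts G) {} A T" "A \<union> T = verts G" "card T \<le> 2 * card A"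
    using splitting_exists[OF finite_verts] by blast
  have "local_resolving_set G T"
    unfolding local_resolving_set_def
  proof (intro conjI ballI impI)
    show "T \<subseteq> verts G" using AT(2) by blast
    fix u v assume uv: "u \<in> verts G - T" "v \<in> verts G - T" "u \<rightarrow>\<^bsub>G\<^esub> v"
    then have "u \<in> A" using AT(2) by blast
    then obtain w where w: "w \<in> T" "(u \<rightarrow>\<^bsub>G\<^esub> w) \<noteq> (v \<rightarrow>\<^bsub>G\<^esub> w)"
      using AT(1) uv unfolding splitting_def by blast
    \<comment> \<open>As \<open>w\<close> differs from \<open>u\<close> and \<open>v\<close>,
      exactly one of the two distances to \<open>w\<close> is 1.\<close>
    have "w \<in> verts G" "u \<noteq> w" "v \<noteq> w" using w AT(2) uv by blast+
    then have "graph_dist G u w \<noteq> graph_dist G v w"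
      using w(2) uv graph_dist_eq_1_iff[OF assms(2), of _ w] by (metis DiffD1)
    then show "\<exists>w\<in>T. distinguishes G w u v" using w(1) unfolding distinguishes_def by blast
  qed
  then have "local_metric_dimension G \<le> card T"
    unfolding local_metric_dimension_def by (intro Least_le) blast
  moreover have "card (verts G) = card A + card T"
    using AT(1,2) finite_verts unfolding splitting_def
    by (metis card_Un_disjoint finite_Un)
  ultimately have "3 * local_metric_dimension G \<le> 2 * card (verts G)" using AT(3) by linarith
  then have "3 * real (local_metric_dimension G) \<le> 2 * real (card (verts G))" by linarith
  then show ?thesis by (simp add: le_floor_iff)
qed

end
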